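(* Let $K\geqslant1$ be a parameter. Let $B_1,B_2\subset\mathbf{Z}$ be finite with $|B_1|\geqslant K$, and let $E\in L^2(\mathbf{T})$ satisfy $\lVert E\rVert_2\leqslant |B_1|^{1/2}/K$. Then $$\lVert\hat 1_{B_1}+\hat 1_{B_2}+E\rVert_1\gg\log K.$$
   Context: $\mathbf{T}=\mathbf{R}/\mathbf{Z}$, $e(t)=e^{2\pi it}$, and for finite $B\subset\mathbf{Z}$, $\hat 1_B(x)=\sum_{n\in B}e(nx)$. $\lVert g\rVert_p=(\int_0^1|g(t)|^p\,dt)^{1/p}$. $X\gg Y$ means $X\geqslant cY$ for an absolute constant $c>0$. *)

theory Defs
  imports "HOL-Analysis.Analysis"
begin

text \<open>Functions on the circle \<open>\<real>/\<int>\<close> are rendered as 1-periodic functions on \<open>\<real>\<close>;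
  integration over the circle is Lebesgue integration over \<open>{0..1}\<close>.\<close>

definition e :: "real \<Rightarrow> complex" where
  "e t = exp (2 * of_real pi * \<i> * of_real t)"

definition fourier_indicator :: "int set \<Rightarrow> real \<Rightarrow> complex" where
  "fourier_indicator B x = (\<Sum>n\<in>B. e (of_int n * x))"

text \<open>The Bochner integral is 0 on non-integrable functions, so \<open>Lp_norm p g\<close> is meaningful
  only if \<open>\<bar>g\<bar>\<^sup>p\<close> is integrable.\<close>

definition Lp_norm :: "real \<Rightarrow> (real \<Rightarrow> complex) \<Rightarrow> real" where
  "Lp_norm p g = (LINT t:{0..1}|lebesgue. norm (g t) powr p) powr (1 / p)"

definition L2_circle :: "(real \<Rightarrow> complex) set" where
  "L2_circle = {g. g \<in> borel_measurable lebesgue \<and> (\<forall>t. g (t + 1) = g t)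
     \<and> set_integrable lebesgue {0..1} (\<lambda>t. (norm (g t))\<^sup>2)}"

end

(* The McGehee-Pigno-Smith argument, restricted to the scales the error term can afford. Let A be the
   union of B1 and B2 and N its size. Split an initial segment of A into consecutive blocks S_j of size 4^j,
   p <= j < q, with 4^p about max(1, N/K^2) and 4^q about N, so that q - p is of order log K. Put
   f_j = 4^(-j) * fourier_indicator (S_j), choose functions H_k, entire in z = e(-x), with Re H_k
   slightly above |f_k|, and test against F = sum_j f_j exp(-(1/8) sum_(k>j) H_k). The damping
   factors keep F bounded; having only nonpositive frequencies, they send f_j only to frequencies below
   the end of S_j, and being close to 1 in L2 they change the coefficients of F on S_l by at most
   half of 4^(-l). Each block then contributes at least 1/2 to the pairing, while the L2 norm of F is at most
   2 * 2^(-p), which makes the pairing with E bounded. For bounded K the normalised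
   indicator of A is a sufficient test function. *)

theory Submission
  imports Defs "HOL-Complex_Analysis.Cauchy_Integral_Formula"
begin

section \<open>Square-integrable functions\<close>

definition square_integrable :: "'a measure \<Rightarrow> ('a \<Rightarrow> complex) \<Rightarrow> bool" where
  "square_integrable M f \<longleftrightarrow> f \<in> borel_measurable M \<and> integrable M (\<lambda>x. (norm (f x))\<^sup>2)"

definition L2_norm :: "'a measure \<Rightarrow> ('a \<Rightarrow> complex) \<Rightarrow> real" where
  "L2_norm M f = sqrt (LINT x|M. (norm (f x))\<^sup>2)"

lemma L2_norm_nonneg: "L2_norm M f \<ge> 0"
  by (simp add: L2_norm_def)

lemma L2_norm_power2: "(L2_norm M f)\<^sup>2 = (LINT x|M. (norm (f x))\<^sup>2)"
  by (simp add: L2_norm_def)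

lemma square_integrable_mult:
  assumes "square_integrable M f" "square_integrable M g"
  shows "integrable M (\<lambda>x. f x * g x)"
proof (rule Bochner_Integration.integrable_bound)
  show "integrable M (\<lambda>x. (norm (f x))\<^sup>2 + (norm (g x))\<^sup>2)"
    using assms by (auto simp: square_integrable_def)
  show "(\<lambda>x. f x * g x) \<in> borel_measurable M"
    using assms by (auto simp: square_integrable_def)
  have "norm (f x * g x) \<le> (norm (f x))\<^sup>2 + (norm (g x))\<^sup>2" for x
    using sum_squares_bound[of "norm (f x)" "norm (g x)"]
      mult_nonneg_nonneg[OF norm_ge_zero[of "f x"] norm_ge_zero[of "g x"]]
    unfolding norm_mult by linarith
  then show "AE x in M. norm (f x * g x) \<le> norm ((norm (f x))\<^sup>2 + (norm (g x))\<^sup>2)"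
    by simp
qed

lemma L2_norm_mult_left: "L2_norm M (\<lambda>x. c * f x) = norm c * L2_norm M f"
  by (simp add: L2_norm_def norm_mult power_mult_distrib real_sqrt_mult)

text \<open>The discriminant criterion behind Cauchy-Schwarz. For \<open>b > 0\<close> the minimum
  sits at \<open>t = c / b\<close>; for \<open>b = 0\<close> the expression is affine in
  \<open>t\<close> and could not stay nonnegative if \<open>c\<close> were positive.\<close>

lemma quadratic_nonneg_imp:
  fixes a b c :: real
  assumes "\<And>t. a - 2 * t * c + t\<^sup>2 * b \<ge> 0" "a \<ge> 0" "b \<ge> 0"
  shows "c \<le> sqrt a * sqrt b"
proof (cases "b = 0")
  case True
  have "c \<le> 0"
  proof (rule ccontr)
    assume "\<not> c \<le> 0"
    then have "2 * ((a + 1) / c) * c = 2 * (a + 1)" by simp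
    then show False using assms(1)[of "(a + 1) / c"] True \<open>a \<ge> 0\<close> by simp
  qed
  then show ?thesis using True by simp
next
  case False
  with \<open>b \<ge> 0\<close> have "b > 0" by simp
  with assms(1)[of "c / b"] have "c\<^sup>2 \<le> a * b"
    by (simp add: field_simps power2_eq_square)
  then have "\<bar>c\<bar> \<le> sqrt (a * b)" by (rule real_le_rsqrt[of "\<bar>c\<bar>", simplified])
  then show ?thesis by (simp add: real_sqrt_mult)
qed

text \<open>The quadratic in \<open>t\<close> is the integral of the square of
  \<open>norm (f x) - t * norm (g x)\<close>. The pairing is bilinear, so conjugates are written out
  wherever it serves as an inner product.\<close>

lemma L2_Cauchy_Schwarz:
  assumes f: "square_integrable M f" and g: "square_integrable M g"
  shows "(LINT x|M. norm (f x) * norm (g x)) \<le> L2_norm M f * L2_norm M g"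
    and "norm (LINT x|M. f x * g x) \<le> L2_norm M f * L2_norm M g"
proof -
  have fg: "integrable M (\<lambda>x. norm (f x) * norm (g x))"
    using integrable_norm[OF square_integrable_mult[OF f g]] by (simp add: norm_mult)
  have ff: "integrable M (\<lambda>x. (norm (f x))\<^sup>2)" and gg: "integrable M (\<lambda>x. (norm (g x))\<^sup>2)"
    using f g by (auto simp: square_integrable_def)
  show 1: "(LINT x|M. norm (f x) * norm (g x)) \<le> L2_norm M f * L2_norm M g"
    unfolding L2_norm_def
  proof (rule quadratic_nonneg_imp)
    fix t :: real
    have "0 \<le> (LINT x|M. (norm (f x) - t * norm (g x))\<^sup>2)" by simp
    also have "(\<lambda>x. (norm (f x) - t * norm (g x))\<^sup>2) =
        (\<lambda>x. (norm (f x))\<^sup>2 - (2 * t) * (norm (f x) * norm (g x)) + t\<^sup>2 * (norm (g x))\<^sup>2)"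
      by (auto simp: power2_eq_square algebra_simps)
    also have "(LINT x|M. (norm (f x))\<^sup>2 - (2 * t) * (norm (f x) * norm (g x)) + t\<^sup>2 * (norm (g x))\<^sup>2)
       = (LINT x|M. (norm (f x))\<^sup>2) - (2 * t) * (LINT x|M. norm (f x) * norm (g x))
          + t\<^sup>2 * (LINT x|M. (norm (g x))\<^sup>2)"
      using fg ff gg by simp
    finally show "0 \<le> (LINT x|M. (norm (f x))\<^sup>2) - 2 * t * (LINT x|M. norm (f x) * norm (g x))
          + t\<^sup>2 * (LINT x|M. (norm (g x))\<^sup>2)" .
  qed auto
  show "norm (LINT x|M. f x * g x) \<le> L2_norm M f * L2_norm M g"
    using integral_norm_bound[of M "\<lambda>x. f x * g x"] 1 by (simp add: norm_mult)
qed

lemma square_integrable_add: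
  assumes f: "square_integrable M f" and g: "square_integrable M g"
  shows "square_integrable M (\<lambda>x. f x + g x)"
  unfolding square_integrable_def
proof (rule conjI)
  show meas: "(\<lambda>x. f x + g x) \<in> borel_measurable M"
    using assms by (auto simp: square_integrable_def)
  show "integrable M (\<lambda>x. (norm (f x + g x))\<^sup>2)"
  proof (rule Bochner_Integration.integrable_bound)
    show "integrable M (\<lambda>x. 2 * (norm (f x))\<^sup>2 + 2 * (norm (g x))\<^sup>2)"
      using assms by (auto simp: square_integrable_def)
    show "(\<lambda>x. (norm (f x + g x))\<^sup>2) \<in> borel_measurable M" using meas by measurable
    have "(norm (f x + g x))\<^sup>2 \<le> 2 * (norm (f x))\<^sup>2 + 2 * (norm (g x))\<^sup>2" for x
    proof -
      have "(norm (f x + g x))\<^sup>2 \<le> (norm (f x) + norm (g x))\<^sup>2"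
        by (intro power_mono norm_triangle_ineq) auto
      also have "\<dots> \<le> 2 * (norm (f x))\<^sup>2 + 2 * (norm (g x))\<^sup>2"
        using sum_squares_bound[of "norm (f x)" "norm (g x)"] by (simp add: power2_sum)
      finally show ?thesis .
    qed
    then show "AE x in M. norm ((norm (f x + g x))\<^sup>2) \<le> norm (2 * (norm (f x))\<^sup>2 + 2 * (norm (g x))\<^sup>2)"
      by simp
  qed
qed

lemma L2_norm_triangle:
  assumes f: "square_integrable M f" and g: "square_integrable M g"
  shows "L2_norm M (\<lambda>x. f x + g x) \<le> L2_norm M f + L2_norm M g"
proof -
  have fg: "integrable M (\<lambda>x. norm (f x) * norm (g x))"
    using integrable_norm[OF square_integrable_mult[OF f g]] by (simp add: norm_mult)
  have ff: "integrable M (\<lambda>x. (norm (f x))\<^sup>2)" and gg: "integrable M (\<lambda>x. (norm (g x))\<^sup>2)"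
    using f g by (auto simp: square_integrable_def)
  have "(L2_norm M (\<lambda>x. f x + g x))\<^sup>2 \<le>
      (LINT x|M. (norm (f x))\<^sup>2 + (norm (g x))\<^sup>2 + 2 * (norm (f x) * norm (g x)))"
    unfolding L2_norm_power2
  proof (rule integral_mono)
    show "integrable M (\<lambda>x. (norm (f x + g x))\<^sup>2)"
      using square_integrable_add[OF f g] by (simp add: square_integrable_def)
    show "integrable M (\<lambda>x. (norm (f x))\<^sup>2 + (norm (g x))\<^sup>2 + 2 * (norm (f x) * norm (g x)))"
      using ff gg fg by simp
    show "(norm (f x + g x))\<^sup>2 \<le> (norm (f x))\<^sup>2 + (norm (g x))\<^sup>2 + 2 * (norm (f x) * norm (g x))" for x
      using power_mono[OF norm_triangle_ineq[of "f x" "g x"], of 2] by (simp add: power2_sum)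
  qed
  also have "\<dots> = (L2_norm M f)\<^sup>2 + (L2_norm M g)\<^sup>2 + 2 * (LINT x|M. norm (f x) * norm (g x))"
    using ff gg fg by (simp add: L2_norm_power2)
  also have "\<dots> \<le> (L2_norm M f + L2_norm M g)\<^sup>2"
    using L2_Cauchy_Schwarz(1)[OF f g] by (simp add: power2_sum)
  finally show ?thesis
    by (rule power2_le_imp_le) (simp add: L2_norm_nonneg)
qed

lemma L2_norm_sum:
  assumes "finite I" "\<And>i. i \<in> I \<Longrightarrow> square_integrable M (f i)"
  shows "square_integrable M (\<lambda>x. \<Sum>i\<in>I. f i x) \<and>
    L2_norm M (\<lambda>x. \<Sum>i\<in>I. f i x) \<le> (\<Sum>i\<in>I. L2_norm M (f i))"
  using assms
proof (induction I rule: finite_induct)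
  case empty
  then show ?case by (simp add: square_integrable_def L2_norm_def)
next
  case (insert i I)
  then have IH: "square_integrable M (\<lambda>x. \<Sum>i\<in>I. f i x)"
    "L2_norm M (\<lambda>x. \<Sum>i\<in>I. f i x) \<le> (\<Sum>i\<in>I. L2_norm M (f i))" and fi: "square_integrable M (f i)"
    by auto
  show ?case
    using square_integrable_add[OF fi IH(1)] L2_norm_triangle[OF fi IH(1)] IH(2) insert.hyps
    by simp
qed

lemma L2_norm_mono:
  assumes "square_integrable M g" "f \<in> borel_measurable M"
    and "\<And>x. x \<in> space M \<Longrightarrow> norm (f x) \<le> norm (g x)"
  shows "square_integrable M f" "L2_norm M f \<le> L2_norm M g"
proof -
  have le: "(norm (f x))\<^sup>2 \<le> (norm (g x))\<^sup>2" if "x \<in> space M" for x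
    using assms(3)[OF that] by (intro power_mono) auto
  show f: "square_integrable M f"
    unfolding square_integrable_def
  proof (rule conjI[OF assms(2)], rule Bochner_Integration.integrable_bound)
    show "integrable M (\<lambda>x. (norm (g x))\<^sup>2)" using assms(1) by (simp add: square_integrable_def)
    show "(\<lambda>x. (norm (f x))\<^sup>2) \<in> borel_measurable M" using assms(2) by measurable
    show "AE x in M. norm ((norm (f x))\<^sup>2) \<le> norm ((norm (g x))\<^sup>2)" using le by auto
  qed
  show "L2_norm M f \<le> L2_norm M g"
    unfolding L2_norm_def using f assms(1) le
    by (intro real_sqrt_le_mono integral_mono) (auto simp: square_integrable_def)
qed

section \<open>Integration over the circle\<close>

abbreviation circle :: "real measure" where
  "circle \<equiv> lebesgue_on {0..1}"

lemma integrable_circle_continuous: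
  fixes f :: "real \<Rightarrow> 'a::euclidean_space"
  assumes "continuous_on UNIV f"
  shows "integrable circle f"
proof -
  have "set_integrable lborel {0..1} f"
    by (rule borel_integrable_atLeastAtMost') (rule continuous_on_subset[OF assms], simp)
  then have "set_integrable lebesgue {0..1} f"
    unfolding set_integrable_def
    by (subst integrable_completion) (auto dest: borel_measurable_integrable)
  then show ?thesis
    by (simp add: integrable_restrict_space set_integrable_def)
qed

lemma square_integrable_circle_continuous:
  assumes "continuous_on UNIV f"
  shows "square_integrable circle f"
  unfolding square_integrable_def
  by (auto intro!: integrable_circle_continuous borel_measurable_integrable continuous_intros assms)

lemma circle_mean_const [simp]: "(LINT x|circle. c) = (c :: 'a::euclidean_space)"
  by (simp add: measure_restrict_space lebesgue_on_UNIV_eq)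

section \<open>Characters and entire functions of \<open>e (- x)\<close>\<close>

lemma e_cmod [simp]: "cmod (e t) = 1"
  by (simp add: e_def norm_exp_eq_Re)

lemma e_add: "e (s + t) = e s * e t"
  by (simp add: e_def exp_add ring_distribs)

lemma e_0 [simp]: "e 0 = 1"
  by (simp add: e_def)

lemma e_1 [simp]: "e 1 = 1"
  by (simp add: e_def)

lemma e_uminus: "e (- t) = cnj (e t)"
  by (simp add: e_def exp_cnj)

lemma e_power: "e t ^ n = e (of_nat n * t)"
  by (induction n) (simp_all add: e_add ring_distribs)

lemma continuous_on_e [continuous_intros]:
  "continuous_on S f \<Longrightarrow> continuous_on S (\<lambda>x. e (f x))"
  unfolding e_def by (intro continuous_intros)

lemma continuous_on_entire_e:
  assumes "\<psi> holomorphic_on UNIV"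
  shows "continuous_on UNIV (\<lambda>x. \<psi> (e (- x)))"
  by (rule continuous_on_compose2[OF holomorphic_on_imp_continuous_on[OF assms]])
     (auto intro!: continuous_intros)

text \<open>If \<open>\<Psi>\<close> is a primitive of \<open>\<psi>\<close>, the derivative of
  \<open>\<Psi> (e (- x))\<close> is \<open>-2 pi i\<close> times the integrand, and
  \<open>e (- x)\<close> returns to its starting value over a period.\<close>

lemma integral_entire_vanish:
  assumes "\<psi> holomorphic_on UNIV"
  shows "(LINT x|circle. e (- x) * \<psi> (e (- x))) = 0"
proof -
  obtain \<Psi> where \<Psi>: "\<And>z. (\<Psi> has_field_derivative \<psi> z) (at z)"
    using holomorphic_convex_primitive'[of UNIV \<psi>] assms by auto
  let ?c = "- (2 * of_real pi * \<i>) :: complex"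
  have der: "((\<lambda>x. \<Psi> (e (- x))) has_vector_derivative ?c * (e (- x) * \<psi> (e (- x)))) (at x within {0..1})"
    for x
  proof -
    have "((\<lambda>w. \<Psi> (exp (?c * w))) has_field_derivative \<psi> (exp (?c * of_real x)) * (exp (?c * of_real x) * ?c))
        (at (of_real x))"
      by (rule DERIV_chain2[OF \<Psi>]) (auto intro!: derivative_eq_intros)
    from has_vector_derivative_real_field[OF this] show ?thesis
      by (simp add: e_def mult_ac)
  qed
  have "((\<lambda>x. ?c * (e (- x) * \<psi> (e (- x)))) has_integral \<Psi> (e (- 1)) - \<Psi> (e (- 0))) {0..1}"
    by (rule fundamental_theorem_of_calculus) (simp_all only: der zero_le_one)
  then have "((\<lambda>x. ?c * (e (- x) * \<psi> (e (- x)))) has_integral 0) {0..1}"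
    by (simp add: e_uminus)
  moreover have int: "integrable circle (\<lambda>x. ?c * (e (- x) * \<psi> (e (- x))))"
    by (intro integrable_circle_continuous continuous_intros continuous_on_entire_e assms)
  ultimately have "(LINT x|circle. ?c * (e (- x) * \<psi> (e (- x)))) = 0"
    using lebesgue_integral_eq_integral[OF int] by (simp only: integral_unique) simp
  then show ?thesis by (simp only: integral_mult_right_zero mult_eq_0_iff) simp
qed

text \<open>The \<open>n - 1\<close> surplus factors \<open>e (- x)\<close> are absorbed into the
  entire function. In Fourier terms, \<open>\<psi> (e (- x))\<close> has only nonpositive
  frequencies.\<close>

lemma integral_e_entire_vanish:
  assumes "\<psi> holomorphic_on UNIV" "n > 0"
  shows "(LINT x|circle. e (- (of_int n * x)) * \<psi> (e (- x))) = 0"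
proof -
  have "e (- (of_int n * x)) * \<psi> (e (- x)) = e (- x) * (e (- x) ^ (nat n - 1) * \<psi> (e (- x)))" for x
  proof -
    have "e (- (of_int n * x)) = e (- x) ^ Suc (nat n - 1)"
      using assms(2) unfolding e_power by simp
    then show ?thesis by (simp only: power_Suc mult.assoc)
  qed
  moreover have "(\<lambda>z. z ^ (nat n - 1) * \<psi> z) holomorphic_on UNIV"
    by (intro holomorphic_intros assms)
  ultimately show ?thesis
    using integral_entire_vanish by (simp only:)
qed

lemma integral_e: "(LINT x|circle. e (of_int n * x)) = of_bool (n = 0)"
proof -
  consider "n = 0" | "n > 0" | "n < 0" by linarith
  then show ?thesis
  proof cases
    case 2
    have "(LINT x|circle. cnj (e (- (of_int n * x)))) = 0"
      using integral_e_entire_vanish[of "\<lambda>_. 1" n] 2 by (simp add: integral_cnj)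
    then show ?thesis using 2 by (simp add: e_uminus)
  next
    case 3
    then show ?thesis using integral_e_entire_vanish[of "\<lambda>_. 1" "- n"] by simp
  qed (simp del: lebesgue_integral_const)
qed

section \<open>Fourier coefficients and mean square of indicators\<close>

lemma continuous_on_fourier_indicator [continuous_intros]:
  "continuous_on UNIV (fourier_indicator B)"
  unfolding fourier_indicator_def by (intro continuous_intros)

lemma norm_fourier_indicator_le: "norm (fourier_indicator B x) \<le> real (card B)"
  unfolding fourier_indicator_def using sum_norm_le[of B "\<lambda>n. e (of_int n * x)" "\<lambda>_. 1"] by simp

lemma fourier_coeff_indicator:
  assumes "finite B"
  shows "(LINT x|circle. e (- (of_int n * x)) * fourier_indicator B x) = of_bool (n \<in> B)"
proof -
  have "e (- (of_int n * x)) * fourier_indicator B x = (\<Sum>m\<in>B. e (of_int (m - n) * x))" for x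
    unfolding fourier_indicator_def sum_distrib_left
    by (rule sum.cong) (auto simp: e_add[symmetric] algebra_simps)
  then have "(LINT x|circle. e (- (of_int n * x)) * fourier_indicator B x) =
      (\<Sum>m\<in>B. LINT x|circle. e (of_int (m - n) * x))"
    by (simp only:)
       (intro Bochner_Integration.integral_sum integrable_circle_continuous continuous_intros)
  also have "\<dots> = of_bool (n \<in> B)"
    using assms by (simp only: integral_e) (simp add: of_bool_def)
  finally show ?thesis .
qed

text \<open>Parseval: in conjugate times function only the conjugate is expanded, which leaves the
  sum of the Fourier coefficients over \<open>B\<close>, each equal to 1.\<close>

lemma L2_norm_fourier_indicator:
  assumes "finite B"
  shows "L2_norm circle (fourier_indicator B) = sqrt (card B)"
proof -
  have "complex_of_real ((norm (fourier_indicator B x))\<^sup>2) =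
      (\<Sum>n\<in>B. e (- (of_int n * x)) * fourier_indicator B x)" for x
    unfolding complex_norm_square sum_distrib_right[symmetric]
    by (simp add: fourier_indicator_def e_uminus mult.commute)
  then have "(LINT x|circle. complex_of_real ((norm (fourier_indicator B x))\<^sup>2)) =
      (\<Sum>n\<in>B. LINT x|circle. e (- (of_int n * x)) * fourier_indicator B x)"
    by (simp only:)
       (intro Bochner_Integration.integral_sum integrable_circle_continuous continuous_intros)
  also have "\<dots> = of_nat (card B)"
    by (simp add: fourier_coeff_indicator[OF assms])
  finally have "(LINT x|circle. (norm (fourier_indicator B x))\<^sup>2) = real (card B)"
    by (simp only: integral_complex_of_real) (metis of_real_eq_iff of_real_of_nat_eq)
  then show ?thesis by (simp add: L2_norm_def)
qed

section \<open>Analytic majorants\<close>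

text \<open>Induction along Horner's scheme: for \<open>norm z = 1\<close> the square of
  \<open>norm (a + z * w)\<close> is the sum of the squares of \<open>norm a\<close> and
  \<open>norm w\<close> plus \<open>2 * Re (cnj a * z * w)\<close>. The value at 0 stays real
  because the added constant is real and the cross term vanishes there.\<close>

lemma norm_poly_circle_eq_Re:
  "\<exists>P. Im (poly P 0) = 0 \<and> (\<forall>z. norm z = 1 \<longrightarrow> (norm (poly q z))\<^sup>2 = Re (poly P z))"
proof (induction q)
  case 0
  show ?case by (rule exI[of _ 0]) simp
next
  case (pCons a q)
  then obtain P where P: "Im (poly P 0) = 0" "\<And>z. norm z = 1 \<Longrightarrow> (norm (poly q z))\<^sup>2 = Re (poly P z)"
    by auto
  have "(norm (poly (pCons a q) z))\<^sup>2 = Re (poly (P + [:of_real ((norm a)\<^sup>2):] + smult (2 * cnj a) (pCons 0 q)) z)"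
    if z: "norm z = 1" for z
  proof -
    have "(norm (a + w))\<^sup>2 = (norm a)\<^sup>2 + (norm w)\<^sup>2 + 2 * Re (cnj a * w)" for w
      unfolding cmod_power2 by (simp add: power2_eq_square algebra_simps)
    from this[of "z * poly q z"] show ?thesis
      using P(2)[OF z] z by (simp add: norm_mult mult_ac)
  qed
  then show ?case
    using P(1) by (intro exI[of _ "P + [:of_real ((norm a)\<^sup>2):] + smult (2 * cnj a) (pCons 0 q)"]) auto
qed

text \<open>Weierstrass' theorem for the square root writes \<open>\<bar>q\<bar>\<close> approximately as a real polynomial in
  \<open>\<bar>q\<bar>\<^sup>2\<close>, and each power \<open>\<bar>q\<bar>\<^sup>2\<^sup>i = \<bar>q\<^sup>i\<bar>\<^sup>2\<close> is the real part of a polynomial.\<close>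

lemma analytic_majorant:
  assumes q: "\<And>z. norm z = 1 \<Longrightarrow> norm (poly q z) \<le> 1" and "\<delta> > 0"
  shows "\<exists>H. H holomorphic_on UNIV \<and> Im (H 0) = 0 \<and>
    (\<forall>z. norm z = 1 \<longrightarrow> norm (poly q z) \<le> Re (H z) \<and> Re (H z) \<le> norm (poly q z) + \<delta>)"
proof -
  have "continuous_on {0..1::real} sqrt" by (intro continuous_intros)
  then obtain p where "real_polynomial_function p" and p: "\<And>t. t \<in> {0..1} \<Longrightarrow> \<bar>sqrt t - p t\<bar> < \<delta> / 2"
    using Stone_Weierstrass_real_polynomial_function[of "{0..1}" sqrt "\<delta> / 2"] \<open>\<delta> > 0\<close> by auto
  then obtain a n where pa: "p = (\<lambda>t. \<Sum>i\<le>n. a i * t ^ i)"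
    unfolding real_polynomial_function_iff_sum by auto
  obtain P where P0: "\<And>i. Im (poly (P i) 0) = 0"
    and P: "\<And>i z. norm z = 1 \<Longrightarrow> (norm (poly (q ^ i) z))\<^sup>2 = Re (poly (P i) z)"
    using norm_poly_circle_eq_Re[of "q ^ _"] by metis
  \<comment> \<open>Adding half of \<open>\<delta>\<close> turns the two-sided error
    \<open>\<delta> / 2\<close> into a majorant that overshoots by at most
    \<open>\<delta>\<close>.\<close>
  define H where "H z = (\<Sum>i\<le>n. of_real (a i) * poly (P i) z) + of_real (\<delta> / 2)" for z
  have "H holomorphic_on UNIV"
    unfolding H_def by (intro holomorphic_intros)
  moreover have "Im (H 0) = 0"
    by (simp add: H_def P0)
  moreover have "norm (poly q z) \<le> Re (H z) \<and> Re (H z) \<le> norm (poly q z) + \<delta>" if z: "norm z = 1" for z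
  proof -
    have "Re (H z) = (\<Sum>i\<le>n. a i * ((norm (poly q z))\<^sup>2) ^ i) + \<delta> / 2"
      by (simp add: H_def P[OF z, symmetric] poly_power norm_power power_mult[symmetric] mult.commute)
    then have "Re (H z) = p ((norm (poly q z))\<^sup>2) + \<delta> / 2" by (simp add: pa)
    moreover have "\<bar>sqrt ((norm (poly q z))\<^sup>2) - p ((norm (poly q z))\<^sup>2)\<bar> < \<delta> / 2"
      using q[OF z] by (intro p) (simp add: power_le_one)
    ultimately show ?thesis by (simp add: abs_if split: if_splits)
  qed
  ultimately show ?thesis by blast
qed

text \<open>The mean of \<open>H\<^sup>2\<close> is \<open>H(0)\<^sup>2 \<ge> 0\<close>, so the imaginary part has the smaller mean square.\<close>

lemma L2_norm_entire_le:
  assumes H: "H holomorphic_on UNIV" and H0: "Im (H 0) = 0"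
  shows "(L2_norm circle (\<lambda>x. H (e (- x))))\<^sup>2 \<le> 2 * (LINT x|circle. (Re (H (e (- x))))\<^sup>2)"
proof -
  have cont: "continuous_on UNIV (\<lambda>x. H (e (- x)))"
    by (rule continuous_on_entire_e[OF H])
  \<comment> \<open>The constant term is split off: the quotient of the difference by
    \<open>z\<close> has a removable singularity at 0, and the remainder \<open>z * h z\<close> has
    mean zero on the circle.\<close>
  obtain h where h: "h holomorphic_on UNIV" and Hh: "\<And>z. (H z)\<^sup>2 = (H 0)\<^sup>2 + z * h z"
  proof -
    have "(\<lambda>z. if z = 0 then deriv (\<lambda>z. (H z)\<^sup>2 - (H 0)\<^sup>2) 0
        else ((H z)\<^sup>2 - (H 0)\<^sup>2) / z - ((H 0)\<^sup>2 - (H 0)\<^sup>2) / (z - 0)) holomorphic_on UNIV"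
      by (rule pole_theorem) (auto intro!: holomorphic_intros H)
    then show ?thesis
      by (rule that) auto
  qed
  have 1: "integrable circle (\<lambda>x. (H (e (- x)))\<^sup>2)"
    by (intro integrable_circle_continuous continuous_intros cont)
  have "(LINT x|circle. (H (e (- x)))\<^sup>2) = (LINT x|circle. (H 0)\<^sup>2 + e (- x) * h (e (- x)))"
    by (rule arg_cong[of _ _ "integral\<^sup>L circle"], rule ext) (rule Hh)
  also have "\<dots> = (H 0)\<^sup>2 + (LINT x|circle. e (- x) * h (e (- x)))"
    by (subst Bochner_Integration.integral_add, (intro integrable_circle_continuous continuous_intros
      continuous_on_entire_e h)+) (simp only: circle_mean_const)
  also have "\<dots> = (H 0)\<^sup>2"
    using integral_entire_vanish[OF h] by simp
  finally have "Re (LINT x|circle. (H (e (- x)))\<^sup>2) = (Re (H 0))\<^sup>2"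
    using H0 by (simp add: power2_eq_square)
  then have "0 \<le> (LINT x|circle. Re ((H (e (- x)))\<^sup>2))"
    using 1 by simp
  \<comment> \<open>Uses that the real part of the square of \<open>w\<close> is twice the square of
    \<open>Re w\<close> minus the square of \<open>norm w\<close>.\<close>
  then have "0 \<le> (LINT x|circle. 2 * (Re (H (e (- x))))\<^sup>2 - (norm (H (e (- x))))\<^sup>2)"
    by (simp add: cmod_power2) (simp add: power2_eq_square)
  also have "\<dots> = 2 * (LINT x|circle. (Re (H (e (- x))))\<^sup>2) - (LINT x|circle. (norm (H (e (- x))))\<^sup>2)"
    by (subst Bochner_Integration.integral_diff)
       (auto intro!: integrable_circle_continuous continuous_intros cont)
  finally show ?thesis by (simp add: L2_norm_power2)
qed

text \<open>Mean value inequality on the right half-plane, where the derivative of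
  \<open>exp (- w)\<close> has modulus at most 1.\<close>

lemma norm_exp_minus_one_le:
  assumes "Re w \<ge> 0"
  shows "norm (exp (- w) - 1) \<le> norm w"
proof -
  have "norm (exp (- w) - exp (- 0)) \<le> 1 * norm (w - 0)"
  proof (rule field_differentiable_bound)
    show "convex {w. Re w \<ge> 0}" by (rule convex_halfspace_Re_ge)
    show "((\<lambda>w. exp (- w)) has_field_derivative - exp (- z)) (at z within {w. Re w \<ge> 0})" for z
      by (auto intro!: derivative_eq_intros)
  qed (use assms in auto)
  then show ?thesis by simp
qed

text \<open>The invariant behind \<open>norm_F_le\<close>: damping a quantity of size 16 frees room
  for a new term of size \<open>s\<close>. The constants 16 and 1/8 fit because
  \<open>(1 + s / 8) * (1 - s / 16) = 1 + s / 16 - s * s / 128\<close>, which is at least 1 on the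
  unit interval.\<close>

lemma exp_damping_bound:
  fixes s t :: real
  assumes "0 \<le> s" "s \<le> 1" "s \<le> t"
  shows "16 * exp (- (t / 8)) + s \<le> 16"
proof -
  have "exp (- (t / 8)) \<le> exp (- (s / 8))" using assms by simp
  also have "\<dots> \<le> 1 - s / 16"
  proof -
    have "1 \<le> (1 + s / 8) * (1 - s / 16)"
      using assms mult_left_mono[of s 1 s] by (simp add: field_simps)
    also have "\<dots> \<le> exp (s / 8) * (1 - s / 16)"
      using assms exp_ge_add_one_self[of "s / 8"] by (intro mult_right_mono) auto
    finally show ?thesis by (simp add: exp_minus field_simps)
  qed
  finally show ?thesis by simp
qed

section \<open>The test function\<close>

lemma sum_geometric_le:
  fixes r :: real
  assumes "0 \<le> r" "r < 1"
  shows "(\<Sum>j\<in>{l..<q}. r ^ j) \<le> r ^ l / (1 - r)"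
proof (cases "l \<le> q")
  case True
  then have "(1 - r) * (\<Sum>j\<in>{l..<q}. r ^ j) = r ^ l - r ^ q"
    by (induction q rule: dec_induct) (auto simp: ring_distribs)
  also have "\<dots> \<le> r ^ l" using assms by simp
  finally show ?thesis using assms by (simp add: field_simps)
qed (use assms in auto)

text \<open>Multiplying by a character keeps the modulus, so the top frequency can be moved to 0.
  What remains is a polynomial in \<open>e (- x)\<close>, the form that
  \<open>analytic_majorant\<close> expects.\<close>

lemma norm_fourier_indicator_eq_poly:
  assumes "finite B"
  shows "\<exists>q. (\<forall>x. norm (fourier_indicator B x) = norm (poly q (e (- x)))) \<and>
    (\<forall>z. norm z = 1 \<longrightarrow> norm (poly q z) \<le> real (card B))"
proof (intro exI conjI allI impI)
  let ?q = "\<Sum>n\<in>B. monom (1::complex) (nat (Max B - n))"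
  fix x
  have "fourier_indicator B x = e (of_int (Max B) * x) * poly ?q (e (- x))"
    unfolding fourier_indicator_def poly_sum sum_distrib_left
  proof (rule sum.cong[OF refl])
    fix n assume "n \<in> B"
    then have "n \<le> Max B" using assms by simp
    then show "e (of_int n * x) = e (of_int (Max B) * x) * poly (monom 1 (nat (Max B - n))) (e (- x))"
      by (simp add: poly_monom e_power e_add[symmetric]) (simp add: algebra_simps)
  qed
  then show "norm (fourier_indicator B x) = norm (poly ?q (e (- x)))"
    by (simp add: norm_mult)
next
  fix z :: complex assume "norm z = 1"
  then show "norm (poly (\<Sum>n\<in>B. monom 1 (nat (Max B - n))) z) \<le> real (card B)"
    unfolding poly_sum
    using sum_norm_le[of B "\<lambda>n. poly (monom 1 (nat (Max B - n))) z" "\<lambda>_. 1"]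
    by (simp add: poly_monom norm_power)
qed

text \<open>With sizes \<open>4 ^ j\<close>, the normalised block sums \<open>f j\<close> are
  bounded by 1 and have L2 norms \<open>(1 / 2) ^ j\<close>, so sums over later scales are
  geometric. The order of the blocks is what makes one-sided frequency support useful.\<close>

locale blocks =
  fixes S :: "nat \<Rightarrow> int set" and p q :: nat
  assumes card_S: "\<And>j. j \<in> {p..<q} \<Longrightarrow> card (S j) = 4 ^ j"
    and S_less: "\<And>i j m n. i \<in> {p..<q} \<Longrightarrow> j \<in> {p..<q} \<Longrightarrow> i < j \<Longrightarrow> m \<in> S i \<Longrightarrow> n \<in> S j \<Longrightarrow> m < n"
begin

lemma finite_S: "j \<in> {p..<q} \<Longrightarrow> finite (S j)"
  \<comment> \<open>An infinite set would have \<open>card\<close> equal to 0, which is no power of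
    4.\<close>
  using card_S by (metis card.infinite power_not_zero zero_neq_numeral)

definition f :: "nat \<Rightarrow> real \<Rightarrow> complex" where
  "f j x = (1 / 4 ^ j) * fourier_indicator (S j) x"

text \<open>An entire substitute for the analytic completion of \<open>norm (f j x)\<close>. The
  slack \<open>(1 / 2) ^ j\<close> equals the L2 norm of \<open>f j\<close>, so it costs only a
  constant factor; the real value at 0 feeds \<open>L2_norm_entire_le\<close>.\<close>

definition is_majorant :: "nat \<Rightarrow> (complex \<Rightarrow> complex) \<Rightarrow> bool" where
  "is_majorant j h \<longleftrightarrow> h holomorphic_on UNIV \<and> Im (h 0) = 0 \<and>
     (\<forall>x. norm (f j x) \<le> Re (h (e (- x))) \<and> Re (h (e (- x))) \<le> norm (f j x) + (1 / 2) ^ j)"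

definition H :: "nat \<Rightarrow> complex \<Rightarrow> complex" where
  "H j = (SOME h. is_majorant j h)"

text \<open>The bound \<open>r\<close> truncates the construction so that \<open>norm_F_le\<close>
  can go by induction on the number of blocks; the test function itself is
  \<open>F q\<close>.\<close>

definition W :: "nat \<Rightarrow> nat \<Rightarrow> complex \<Rightarrow> complex" where
  "W j r z = (\<Sum>k\<in>{j<..<r}. H k z) / 8"

definition F :: "nat \<Rightarrow> real \<Rightarrow> complex" where
  "F r x = (\<Sum>j\<in>{p..<r}. f j x * exp (- W j r (e (- x))))"

context
  fixes j assumes j: "j \<in> {p..<q}"
begin

lemma norm_f_le: "norm (f j x) \<le> 1"
  using norm_fourier_indicator_le[of "S j" x] card_S[OF j]
  by (simp add: f_def norm_mult norm_divide norm_power)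

lemma L2_norm_f: "L2_norm circle (f j) = (1 / 2) ^ j"
proof -
  have "sqrt (4 ^ j) = 2 ^ j" by (simp add: real_sqrt_power)
  moreover have "(4::real) ^ j = 2 ^ j * 2 ^ j" by (simp flip: power_mult_distrib)
  ultimately show ?thesis
    unfolding f_def L2_norm_mult_left
    by (simp add: L2_norm_fourier_indicator finite_S[OF j] card_S[OF j] norm_divide norm_power power_one_over)
qed

lemma is_majorant_H: "is_majorant j (H j)"
proof -
  obtain Q where Q: "\<And>x. norm (fourier_indicator (S j) x) = norm (poly Q (e (- x)))"
    "\<And>z. norm z = 1 \<Longrightarrow> norm (poly Q z) \<le> 4 ^ j"
    using norm_fourier_indicator_eq_poly[OF finite_S[OF j]] card_S[OF j] by auto
  let ?Q = "smult (1 / 4 ^ j) Q"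
  have f_eq: "norm (f j x) = norm (poly ?Q (e (- x)))" for x
    by (simp add: f_def norm_mult norm_divide Q)
  have "\<exists>h. h holomorphic_on UNIV \<and> Im (h 0) = 0 \<and>
    (\<forall>z. norm z = 1 \<longrightarrow> norm (poly ?Q z) \<le> Re (h z) \<and> Re (h z) \<le> norm (poly ?Q z) + (1 / 2) ^ j)"
    using Q(2) by (intro analytic_majorant) (auto simp: norm_mult norm_divide norm_power)
  then have "\<exists>h. is_majorant j h"
    unfolding is_majorant_def f_eq by (elim exE) auto
  then show ?thesis unfolding H_def by (rule someI_ex)
qed

lemma holomorphic_H: "H j holomorphic_on UNIV"
  and norm_f_le_H: "norm (f j x) \<le> Re (H j (e (- x)))"
  using is_majorant_H by (auto simp: is_majorant_def)

text \<open>The real part lies between 0 and \<open>norm (f j x) + (1 / 2) ^ j\<close>, so its mean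
  square is at most \<open>4 * (1 / 4) ^ j\<close>. The imaginary part at most doubles this, and 8
  is below the square of 3.\<close>

lemma L2_norm_H: "L2_norm circle (\<lambda>x. H j (e (- x))) \<le> 3 * (1 / 2) ^ j"
proof (rule power2_le_imp_le)
  have cont: "continuous_on UNIV (\<lambda>x. H j (e (- x)))" "continuous_on UNIV (f j)"
    using continuous_on_entire_e[OF holomorphic_H] by (auto simp: f_def intro!: continuous_intros)
  have "(LINT x|circle. (Re (H j (e (- x))))\<^sup>2) \<le> (LINT x|circle. 2 * (norm (f j x))\<^sup>2 + 2 * ((1 / 2) ^ j)\<^sup>2)"
  proof (rule integral_mono)
    show "(Re (H j (e (- x))))\<^sup>2 \<le> 2 * (norm (f j x))\<^sup>2 + 2 * ((1 / 2) ^ j)\<^sup>2" for x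
    proof -
      have "0 \<le> Re (H j (e (- x)))" using norm_f_le_H[of x] norm_ge_zero[of "f j x"] by linarith
      moreover have "Re (H j (e (- x))) \<le> norm (f j x) + (1 / 2) ^ j"
        using is_majorant_H by (auto simp: is_majorant_def)
      ultimately have "(Re (H j (e (- x))))\<^sup>2 \<le> (norm (f j x) + (1 / 2) ^ j)\<^sup>2"
        by (rule power_mono[rotated])
      also have "\<dots> \<le> 2 * (norm (f j x))\<^sup>2 + 2 * ((1 / 2) ^ j)\<^sup>2"
        using sum_squares_bound[of "norm (f j x)" "(1 / 2) ^ j"] unfolding power2_sum by linarith
      finally show ?thesis .
    qed
  qed (intro integrable_circle_continuous continuous_intros cont)+
  also have "\<dots> = 2 * (L2_norm circle (f j))\<^sup>2 + 2 * ((1 / 2) ^ j)\<^sup>2"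
    unfolding L2_norm_power2
    by (subst Bochner_Integration.integral_add)
       (auto simp del: lebesgue_integral_const intro!: integrable_circle_continuous continuous_intros cont)
  finally have "(LINT x|circle. (Re (H j (e (- x))))\<^sup>2) \<le> 4 * ((1 / 2) ^ j)\<^sup>2"
    by (simp add: L2_norm_f)
  moreover have "Im (H j 0) = 0" using is_majorant_H by (simp add: is_majorant_def)
  ultimately have "(L2_norm circle (\<lambda>x. H j (e (- x))))\<^sup>2 \<le> 8 * ((1 / 2) ^ j)\<^sup>2"
    using L2_norm_entire_le[OF holomorphic_H] by linarith
  then show "(L2_norm circle (\<lambda>x. H j (e (- x))))\<^sup>2 \<le> (3 * (1 / 2) ^ j)\<^sup>2"
    unfolding power_mult_distrib by (rule order_trans) simp
qed simp

end

section \<open>Size of the damped sum\<close>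

lemma continuous_on_f [continuous_intros]: "continuous_on UNIV (f j)"
  by (auto simp: f_def intro!: continuous_intros)

lemma holomorphic_W:
  assumes "p \<le> j" "r \<le> q"
  shows "W j r holomorphic_on UNIV"
  unfolding W_def using assms by (intro holomorphic_intros holomorphic_H) auto

lemma holomorphic_exp_W:
  assumes "p \<le> j" "r \<le> q"
  shows "(\<lambda>z. exp (- W j r z)) holomorphic_on UNIV"
  by (intro holomorphic_intros holomorphic_W assms)

lemma Re_W_nonneg:
  assumes "p \<le> j" "r \<le> q"
  shows "Re (W j r (e (- x))) \<ge> 0"
proof -
  have "0 \<le> Re (H k (e (- x)))" if "k \<in> {j<..<r}" for k
    using that assms by (intro order_trans[OF norm_ge_zero norm_f_le_H]) auto
  then show ?thesis by (auto simp: W_def intro!: sum_nonneg)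
qed

lemma norm_exp_W_le:
  assumes "p \<le> j" "r \<le> q"
  shows "norm (exp (- W j r (e (- x)))) \<le> 1"
  using Re_W_nonneg[OF assms] by (simp add: norm_exp_eq_Re)

lemma continuous_on_exp_W:
  assumes "p \<le> j" "r \<le> q"
  shows "continuous_on UNIV (\<lambda>x. exp (- W j r (e (- x))))"
  by (rule continuous_on_entire_e[OF holomorphic_exp_W[OF assms]])

lemma continuous_on_F: "r \<le> q \<Longrightarrow> continuous_on UNIV (F r)"
  unfolding F_def by (intro continuous_intros continuous_on_exp_W) auto

text \<open>Passing from \<open>r\<close> to \<open>Suc r\<close> multiplies the whole old sum by
  \<open>exp (- H r / 8)\<close> and adds \<open>f r\<close>, still undamped. As
  \<open>Re (H r)\<close> dominates \<open>norm (f r x)\<close>, the damping makes up for the new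
  term.\<close>

lemma norm_F_le:
  assumes "p \<le> r" "r \<le> q"
  shows "norm (F r x) \<le> 16"
  using assms
proof (induction r rule: dec_induct)
  case base
  show ?case by (simp add: F_def)
next
  case (step r)
  have r: "r \<in> {p..<q}" using step by auto
  have "{r<..<Suc r} = {}" by auto
  then have "F (Suc r) x = (\<Sum>j\<in>{p..<r}. f j x * exp (- W j (Suc r) (e (- x)))) + f r x"
    using step.hyps \<open>{r<..<Suc r} = {}\<close> by (simp add: F_def W_def)
  also have "(\<Sum>j\<in>{p..<r}. f j x * exp (- W j (Suc r) (e (- x)))) = F r x * exp (- (H r (e (- x)) / 8))"
    unfolding F_def sum_distrib_right
  proof (rule sum.cong[OF refl])
    fix j assume "j \<in> {p..<r}"
    then have "{j<..<Suc r} = insert r {j<..<r}" by auto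
    then have "- W j (Suc r) (e (- x)) = - W j r (e (- x)) + - (H r (e (- x)) / 8)"
      by (simp add: W_def add_divide_distrib)
    then show "f j x * exp (- W j (Suc r) (e (- x))) =
        f j x * exp (- W j r (e (- x))) * exp (- (H r (e (- x)) / 8))"
      by (simp only: exp_add mult.assoc)
  qed
  finally have "norm (F (Suc r) x) \<le> norm (F r x) * exp (- (Re (H r (e (- x))) / 8)) + norm (f r x)"
    by (metis (no_types, lifting) norm_triangle_ineq norm_mult norm_exp_eq_Re uminus_complex.sel(1) Re_divide_numeral)
  also have "\<dots> \<le> 16 * exp (- (Re (H r (e (- x))) / 8)) + norm (f r x)"
    using step by (intro add_right_mono mult_right_mono) auto
  also have "\<dots> \<le> 16"
    by (intro exp_damping_bound norm_f_le norm_f_le_H r norm_ge_zero)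
  finally show ?case .
qed

text \<open>Damping does not increase the modulus, so the L2 norms of the \<open>f j\<close> form a
  geometric series dominated by the first scale \<open>p\<close>.\<close>

lemma L2_norm_F: "L2_norm circle (F q) \<le> 2 * (1 / 2) ^ p"
proof -
  have "L2_norm circle (\<lambda>x. f j x * exp (- W j q (e (- x)))) \<le> (1 / 2) ^ j" if j: "j \<in> {p..<q}" for j
    unfolding L2_norm_f[OF j, symmetric] using j norm_exp_W_le[of j q]
    by (intro L2_norm_mono(2) square_integrable_circle_continuous
        borel_measurable_integrable integrable_circle_continuous continuous_intros continuous_on_exp_W)
       (auto simp: norm_mult intro!: mult_left_le)
  moreover have "L2_norm circle (F q) \<le> (\<Sum>j\<in>{p..<q}. L2_norm circle (\<lambda>x. f j x * exp (- W j q (e (- x)))))"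
    unfolding F_def
    by (intro L2_norm_sum[THEN conjunct2] square_integrable_circle_continuous continuous_intros
        continuous_on_exp_W) auto
  ultimately have "L2_norm circle (F q) \<le> (\<Sum>j\<in>{p..<q}. (1 / 2) ^ j)"
    by (meson order_trans sum_mono)
  also have "\<dots> \<le> 2 * (1 / 2) ^ p"
    using sum_geometric_le[of "1/2" p q] by simp
  finally show ?thesis .
qed

text \<open>Since \<open>Re W\<close> is nonnegative, the exponential is compared with its exponent.
  The norms \<open>3 * (1 / 2) ^ k\<close> for \<open>k > j\<close> add up to at most
  \<open>3 * (1 / 2) ^ j\<close>, and \<open>W\<close> carries the factor 1/8.\<close>

lemma L2_norm_exp_W:
  assumes j: "j \<in> {p..<q}"
  shows "L2_norm circle (\<lambda>x. exp (- W j q (e (- x))) - 1) \<le> 3 / 8 * (1 / 2) ^ j"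
proof -
  have pj: "p \<le> j" using j by simp
  have H: "square_integrable circle (\<lambda>x. H k (e (- x)))" if "k \<in> {j<..<q}" for k
    using that j by (intro square_integrable_circle_continuous continuous_on_entire_e holomorphic_H) auto
  have "L2_norm circle (\<lambda>x. exp (- W j q (e (- x))) - 1) \<le> L2_norm circle (\<lambda>x. W j q (e (- x)))"
    using norm_exp_minus_one_le[OF Re_W_nonneg[OF pj order_refl]]
    by (intro L2_norm_mono(2) square_integrable_circle_continuous borel_measurable_integrable
        integrable_circle_continuous continuous_intros continuous_on_exp_W
        continuous_on_entire_e holomorphic_W pj) auto
  also have "\<dots> = L2_norm circle (\<lambda>x. \<Sum>k\<in>{j<..<q}. H k (e (- x))) / 8"
    using L2_norm_mult_left[of circle "1/8" "\<lambda>x. \<Sum>k\<in>{j<..<q}. H k (e (- x))"]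
    by (simp add: W_def)
  also have "\<dots> \<le> (\<Sum>k\<in>{j<..<q}. L2_norm circle (\<lambda>x. H k (e (- x)))) / 8"
    using L2_norm_sum[of "{j<..<q}" circle "\<lambda>k x. H k (e (- x))"] H by simp
  also have "\<dots> \<le> (\<Sum>k\<in>{j<..<q}. 3 * (1 / 2) ^ k) / 8"
    using j by (intro divide_right_mono sum_mono L2_norm_H) auto
  also have "{j<..<q} = {Suc j..<q}" by auto
  also have "(\<Sum>k\<in>{Suc j..<q}. 3 * (1 / 2) ^ k) / 8 \<le> 3 / 8 * (1 / 2 :: real) ^ j"
    using sum_geometric_le[of "1/2" "Suc j" q] by (simp flip: sum_distrib_left)
  finally show ?thesis .
qed

section \<open>Fourier coefficients of the test function\<close>

text \<open>A character of frequency \<open>m\<close> in \<open>S j\<close> leaves the coefficient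
  of \<open>\<psi> (e (- x))\<close> at the positive frequency \<open>n - m\<close>, which
  vanishes.\<close>

lemma fourier_coeff_above:
  assumes j: "j \<in> {p..<q}" and n: "\<And>m. m \<in> S j \<Longrightarrow> m < n" and "\<psi> holomorphic_on UNIV"
  shows "(LINT x|circle. e (- (of_int n * x)) * (f j x * \<psi> (e (- x)))) = 0"
proof -
  have "e (- (of_int n * x)) * (f j x * \<psi> (e (- x))) =
      (\<Sum>m\<in>S j. (1 / 4 ^ j) * (e (- (of_int (n - m) * x)) * \<psi> (e (- x))))" for x
    unfolding f_def fourier_indicator_def sum_distrib_left sum_distrib_right
    by (rule sum.cong) (auto simp: e_add[symmetric] algebra_simps)
  then have "(LINT x|circle. e (- (of_int n * x)) * (f j x * \<psi> (e (- x)))) =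
      (\<Sum>m\<in>S j. LINT x|circle. (1 / 4 ^ j) * (e (- (of_int (n - m) * x)) * \<psi> (e (- x))))"
    by (simp only:)
       (intro Bochner_Integration.integral_sum integrable_circle_continuous continuous_intros
         continuous_on_entire_e assms(3))
  also have "\<dots> = 0"
    by (intro sum.neutral ballI)
       (simp only: integral_mult_right_zero integral_e_entire_vanish[OF assms(3)] n diff_gt_0_iff_gt mult_zero_right)
  finally show ?thesis .
qed

lemma fourier_coeff_F_eq:
  "(LINT x|circle. e (- (of_int n * x)) * F q x) =
    (\<Sum>j\<in>{p..<q}. LINT x|circle. e (- (of_int n * x)) * (f j x * exp (- W j q (e (- x)))))"
  unfolding F_def sum_distrib_left
  by (intro Bochner_Integration.integral_sum integrable_circle_continuous continuous_intros
    continuous_on_exp_W) auto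

text \<open>Handles the points above all blocks: they add nothing to the pairing, so the blocks may
  stop at any initial segment.\<close>

lemma fourier_coeff_F_zero:
  assumes "\<And>j m. j \<in> {p..<q} \<Longrightarrow> m \<in> S j \<Longrightarrow> m < n"
  shows "(LINT x|circle. e (- (of_int n * x)) * F q x) = 0"
  unfolding fourier_coeff_F_eq using assms
  by (intro sum.neutral ballI fourier_coeff_above holomorphic_exp_W) auto

lemma fourier_coeff_f:
  assumes "j \<in> {p..<q}" "l \<in> {p..<q}" "n \<in> S l"
  shows "(LINT x|circle. e (- (of_int n * x)) * f j x) = of_bool (j = l) / 4 ^ l"
proof -
  have "n \<in> S j \<longleftrightarrow> j = l"
    using assms S_less[of j l n n] S_less[of l j n n] by (cases j l rule: linorder_cases) auto
  moreover have "e (- (of_int n * x)) * f j x = (1 / 4 ^ j) * (e (- (of_int n * x)) * fourier_indicator (S j) x)" for x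
    by (simp add: f_def)
  ultimately show ?thesis
    by (simp only: integral_mult_right_zero fourier_coeff_indicator finite_S[OF assms(1)]) simp
qed

text \<open>Blocks before \<open>l\<close> contribute nothing at \<open>n\<close>. For each block
  from \<open>l\<close> on, Cauchy-Schwarz bounds the change caused by damping by
  \<open>(1 / 2) ^ j\<close> times \<open>3 / 8 * (1 / 2) ^ j\<close>.\<close>

lemma fourier_coeff_F:
  assumes l: "l \<in> {p..<q}" and n: "n \<in> S l"
  shows "norm ((LINT x|circle. e (- (of_int n * x)) * F q x) - 1 / 4 ^ l) \<le> 1 / 2 * (1 / 4) ^ l"
proof -
  \<comment> \<open>The subtracted term is the coefficient at \<open>n\<close> of the undamped
    \<open>f j\<close>, so \<open>D j\<close> measures the effect of damping alone.\<close>
  define D where "D j = (LINT x|circle. e (- (of_int n * x)) * (f j x * exp (- W j q (e (- x)))))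
    - of_bool (j = l) / 4 ^ l" for j
  have D0: "D j = 0" if "j \<in> {p..<q}" "j < l" for j
    using that l n S_less unfolding D_def
    by (subst fourier_coeff_above) (auto intro: holomorphic_exp_W)
  have D1: "norm (D j) \<le> 3 / 8 * (1 / 4) ^ j" if j: "j \<in> {p..<q}" for j
  proof -
    have pj: "p \<le> j" using j by simp
    have "D j = (LINT x|circle. e (- (of_int n * x)) * (f j x * exp (- W j q (e (- x)))) -
        e (- (of_int n * x)) * f j x)"
      unfolding D_def fourier_coeff_f[OF j l n, symmetric] using pj
      by (intro Bochner_Integration.integral_diff[symmetric] integrable_circle_continuous continuous_intros
        continuous_on_exp_W) auto
    also have "\<dots> = (LINT x|circle. (e (- (of_int n * x)) * f j x) * (exp (- W j q (e (- x))) - 1))"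
      by (simp add: algebra_simps)
    also have "norm \<dots> \<le> L2_norm circle (\<lambda>x. e (- (of_int n * x)) * f j x) *
        L2_norm circle (\<lambda>x. exp (- W j q (e (- x))) - 1)"
      using pj
      by (intro L2_Cauchy_Schwarz(2) square_integrable_circle_continuous continuous_intros
        continuous_on_exp_W) auto
    also have "L2_norm circle (\<lambda>x. e (- (of_int n * x)) * f j x) = (1 / 2) ^ j"
      unfolding L2_norm_f[OF j, symmetric] by (simp add: L2_norm_def norm_mult)
    also have "(1 / 2) ^ j * L2_norm circle (\<lambda>x. exp (- W j q (e (- x))) - 1) \<le>
        (1 / 2) ^ j * (3 / 8 * (1 / 2) ^ j)"
      by (intro mult_left_mono L2_norm_exp_W j) simp
    also have "\<dots> = 3 / 8 * (1 / 4) ^ j"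
      by (simp flip: power_mult_distrib)
    finally show ?thesis .
  qed
  have "(LINT x|circle. e (- (of_int n * x)) * F q x) - 1 / 4 ^ l = (\<Sum>j\<in>{p..<q}. D j)"
    using l by (simp add: D_def fourier_coeff_F_eq sum_subtractf of_bool_def if_distrib[of "\<lambda>x. x / _"] cong: if_cong)
  also have "\<dots> = (\<Sum>j\<in>{l..<q}. D j)"
    using l D0 by (intro sum.mono_neutral_right) auto
  also have "norm \<dots> \<le> (\<Sum>j\<in>{l..<q}. 3 / 8 * (1 / 4) ^ j)"
    using l by (intro sum_norm_le D1) auto
  also have "\<dots> = 3 / 8 * (\<Sum>j\<in>{l..<q}. (1 / 4) ^ j)"
    by (rule sum_distrib_left[symmetric])
  \<comment> \<open>The ratio 1/4 gives the factor 4/3, and \<open>3/8 * 4/3 = 1/2\<close>; the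
    weight 1/8 in \<open>W\<close> thus leaves half of the main term.\<close>
  also have "\<dots> \<le> 1 / 2 * (1 / 4) ^ l"
    using sum_geometric_le[of "1/4" l q] by simp
  finally show ?thesis .
qed

end

section \<open>Duality\<close>

lemma initial_segment_exists:
  fixes A :: "'a::linorder set"
  assumes "finite A" "n \<le> card A"
  shows "\<exists>T\<subseteq>A. card T = n \<and> (\<forall>x\<in>T. \<forall>y\<in>A - T. x < y)"
  using assms(2)
proof (induction n)
  case 0
  show ?case by (intro exI[of _ "{}"]) simp
next
  case (Suc n)
  then obtain T where T: "T \<subseteq> A" "card T = n" "\<forall>x\<in>T. \<forall>y\<in>A - T. x < y" by auto
  have fin: "finite (A - T)" "finite T" using assms(1) T(1) by (auto intro: finite_subset)
  have "A - T \<noteq> {}" using T Suc.prems by auto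
  define m where "m = Min (A - T)"
  have m: "m \<in> A - T" "\<And>y. y \<in> A - T \<Longrightarrow> m \<le> y"
    unfolding m_def using Min_in[OF fin(1) \<open>A - T \<noteq> {}\<close>] Min_le[OF fin(1)] by blast+
  show ?case
    using T m fin by (intro exI[of _ "insert m T"]) (auto simp: order.strict_iff_order)
qed

text \<open>Each new block consists of the smallest points not yet used. The bound
  \<open>4 ^ q\<close> on the union is the invariant that guarantees enough points remain.\<close>

lemma blocks_exist:
  assumes "finite A" "p \<le> q" "4 ^ q \<le> card A"
  shows "\<exists>S. blocks S p q \<and> (\<Union>j\<in>{p..<q}. S j) \<subseteq> A \<and> card (\<Union>j\<in>{p..<q}. S j) \<le> 4 ^ q \<and>
    (\<forall>m\<in>(\<Union>j\<in>{p..<q}. S j). \<forall>n\<in>A - (\<Union>j\<in>{p..<q}. S j). m < n)"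
  using assms(2,3)
proof (induction q rule: dec_induct)
  case base
  show ?case by (simp add: blocks_def)
next
  case (step q)
  define U where "U S = (\<Union>j\<in>{p..<q}. S j)" for S :: "nat \<Rightarrow> int set"
  from step obtain S where S: "blocks S p q" "U S \<subseteq> A" "card (U S) \<le> 4 ^ q"
    "\<forall>m\<in>U S. \<forall>n\<in>A - U S. m < n"
    unfolding U_def by auto
  \<comment> \<open>Here \<open>A\<close> has at least \<open>4 * 4 ^ q\<close> points, of which at
    most \<open>4 ^ q\<close> are used.\<close>
  have "4 ^ q \<le> card (A - U S)"
    using S(2,3) step.prems assms(1) card_Diff_subset[of "U S" A] finite_subset by fastforce
  then obtain T where T: "T \<subseteq> A - U S" "card T = 4 ^ q" "\<forall>x\<in>T. \<forall>y\<in>A - U S - T. x < y"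
    using initial_segment_exists[of "A - U S" "4 ^ q"] assms(1) by auto
  let ?S = "S(q := T)"
  have U': "(\<Union>j\<in>{p..<Suc q}. ?S j) = U S \<union> T"
    using step.hyps by (auto simp: U_def less_Suc_eq)
  have "blocks ?S p (Suc q)"
  proof
    show "card (?S j) = 4 ^ j" if "j \<in> {p..<Suc q}" for j
      using that T(2) blocks.card_S[OF S(1), of j] by (auto simp: less_Suc_eq)
    show "m < n" if "i \<in> {p..<Suc q}" "j \<in> {p..<Suc q}" "i < j" "m \<in> ?S i" "n \<in> ?S j" for i j m n
    proof (cases "j = q")
      case True
      then have "m \<in> U S" "n \<in> A - U S" using that T(1) by (auto simp: U_def)
      then show ?thesis using S(4) by blast
    next
      case False
      then show ?thesis using that blocks.S_less[OF S(1), of i j m n] by auto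
    qed
  qed
  moreover have "card (U S \<union> T) \<le> 4 ^ Suc q"
    using card_Un_le[of "U S" T] S(3) T(2) by simp
  ultimately show ?case
    unfolding U'[symmetric] using S T unfolding U'
    by (intro exI[of _ ?S]) (auto simp: U' simp del: fun_upd_apply)
qed

lemma L2_circle_square_integrable:
  assumes "E \<in> L2_circle"
  shows "square_integrable circle E"
  using assms
  by (auto simp: L2_circle_def square_integrable_def set_integrable_def integrable_restrict_space
    intro: measurable_restrict_space1)

lemma Lp_norm_1_eq: "Lp_norm 1 g = (LINT x|circle. norm (g x))"
proof -
  have "0 \<le> (LINT x|circle. norm (g x))" by simp
  then show ?thesis
    by (simp add: Lp_norm_def set_lebesgue_integral_def integral_restrict_space)
qed

lemma Lp_norm_2_eq: "Lp_norm 2 g = L2_norm circle g"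
proof -
  have "0 \<le> (LINT x|circle. (norm (g x))\<^sup>2)" by simp
  then show ?thesis
    by (simp add: Lp_norm_def L2_norm_def set_lebesgue_integral_def integral_restrict_space powr_half_sqrt)
qed

text \<open>The conjugate of the sum is paired with \<open>F\<close>: the sup bound on
  \<open>F\<close> controls the pairing by the L1 norm, and Cauchy-Schwarz controls the share of
  \<open>E\<close>. Nonnegative coefficients allow the doubly counted points of
  \<open>B1 \<inter> B2\<close> to be counted once.\<close>

lemma duality_lower_bound:
  assumes fin: "finite B1" "finite B2" and E: "square_integrable circle E"
    and F: "continuous_on UNIV F" "\<And>x. norm (F x) \<le> C"
    and nonneg: "\<And>n. n \<in> B1 \<union> B2 \<Longrightarrow> Re (LINT x|circle. e (- (of_int n * x)) * F x) \<ge> 0"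
  shows "(\<Sum>n\<in>B1 \<union> B2. Re (LINT x|circle. e (- (of_int n * x)) * F x)) - L2_norm circle E * L2_norm circle F
    \<le> C * (LINT x|circle. norm (fourier_indicator B1 x + fourier_indicator B2 x + E x))"
proof -
  define a where "a n = (LINT x|circle. e (- (of_int n * x)) * F x)" for n
  define g where "g x = fourier_indicator B1 x + fourier_indicator B2 x + E x" for x
  have F2: "square_integrable circle F" by (rule square_integrable_circle_continuous[OF F(1)])
  have cnj: "square_integrable circle (\<lambda>x. cnj (h x))" if "square_integrable circle h" for h
    using that by (auto simp: square_integrable_def
      intro!: measurable_compose[OF _ borel_measurable_continuous_onI[of cnj]] continuous_intros)
  have E': "square_integrable circle (\<lambda>x. cnj (E x))"
    by (rule cnj[OF E])
  have g: "square_integrable circle g"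
    unfolding g_def
    by (intro square_integrable_add E square_integrable_circle_continuous continuous_intros)
  \<comment> \<open>Square integrability gives integrability because the circle has finite
    measure.\<close>
  have "norm (g x) \<le> 1 + (norm (g x))\<^sup>2" for x
    using sum_squares_bound[of 1 "norm (g x)"] norm_ge_zero[of "g x"] unfolding one_power2 by linarith
  moreover have "integrable circle (\<lambda>x. 1 + (norm (g x))\<^sup>2)"
    using g by (intro Bochner_Integration.integrable_add integrable_circle_continuous[of "\<lambda>_. 1"])
      (auto simp: square_integrable_def)
  ultimately have int_g: "integrable circle g"
    using g by (intro Bochner_Integration.integrable_bound[of circle "\<lambda>x. 1 + (norm (g x))\<^sup>2" g]) (auto simp: square_integrable_def)
  have coeff: "(LINT x|circle. cnj (fourier_indicator B x) * F x) = (\<Sum>n\<in>B. a n)" for B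
  proof -
    have "cnj (fourier_indicator B x) * F x = (\<Sum>n\<in>B. e (- (of_int n * x)) * F x)" for x
      by (simp add: fourier_indicator_def sum_distrib_right e_uminus)
    then show ?thesis
      unfolding a_def
      by (simp only:)
        (intro Bochner_Integration.integral_sum integrable_circle_continuous continuous_intros F)
  qed
  have "(LINT x|circle. cnj (g x) * F x) = (LINT x|circle. cnj (fourier_indicator B1 x) * F x +
      cnj (fourier_indicator B2 x) * F x + cnj (E x) * F x)"
    by (simp add: g_def ring_distribs)
  also have "\<dots> = (\<Sum>n\<in>B1. a n) + (\<Sum>n\<in>B2. a n) + (LINT x|circle. cnj (E x) * F x)"
    unfolding coeff[symmetric]
    by (subst Bochner_Integration.integral_add, (intro Bochner_Integration.integrable_add
        integrable_circle_continuous continuous_intros F square_integrable_mult[OF E' F2])+,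
        subst Bochner_Integration.integral_add, (intro integrable_circle_continuous continuous_intros F)+)
      (rule refl)
  finally have eq: "(LINT x|circle. cnj (g x) * F x) =
    (\<Sum>n\<in>B1. a n) + (\<Sum>n\<in>B2. a n) + (LINT x|circle. cnj (E x) * F x)" .
  have "norm (LINT x|circle. cnj (g x) * F x) \<le> (LINT x|circle. norm (cnj (g x) * F x))"
    by (rule integral_norm_bound)
  also have "\<dots> \<le> (LINT x|circle. C * norm (g x))"
  proof (rule integral_mono)
    show "integrable circle (\<lambda>x. norm (cnj (g x) * F x))"
      by (intro integrable_norm square_integrable_mult cnj g F2)
    show "integrable circle (\<lambda>x. C * norm (g x))" using int_g by simp
    show "norm (cnj (g x) * F x) \<le> C * norm (g x)" for x
      using mult_right_mono[OF F(2)[of x] norm_ge_zero[of "g x"]] by (simp add: norm_mult mult.commute)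
  qed
  finally have le: "Re (LINT x|circle. cnj (g x) * F x) \<le> C * (LINT x|circle. norm (g x))"
    using complex_Re_le_cmod[of "LINT x|circle. cnj (g x) * F x"] by simp
  have "L2_norm circle (\<lambda>x. cnj (E x)) = L2_norm circle E" by (simp add: L2_norm_def)
  then have "- Re (LINT x|circle. cnj (E x) * F x) \<le> L2_norm circle E * L2_norm circle F"
    using L2_Cauchy_Schwarz(2)[OF E' F2] abs_Re_le_cmod[of "LINT x|circle. cnj (E x) * F x"]
    by (simp only:)
  moreover have "(\<Sum>n\<in>B1 \<union> B2. Re (a n)) \<le> (\<Sum>n\<in>B1. Re (a n)) + (\<Sum>n\<in>B2. Re (a n))"
  proof -
    have "0 \<le> (\<Sum>n\<in>B1 \<inter> B2. Re (a n))"
      using nonneg by (intro sum_nonneg) (auto simp: a_def)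
    then show ?thesis using sum.union_inter[OF fin, of "\<lambda>n. Re (a n)"] by linarith
  qed
  ultimately show ?thesis
    using le unfolding eq a_def[symmetric] g_def[symmetric] by simp
qed

text \<open>Block \<open>j\<close> has \<open>4 ^ j\<close> points, each with coefficient of real
  part at least half of \<open>(1 / 4) ^ j\<close>, so every scale gains 1/2. For
  \<open>p > q\<close> the left side is nonpositive.\<close>

lemma L1_norm_lower_bound_scales:
  assumes fin: "finite B1" "finite B2" and E: "square_integrable circle E"
    and q: "4 ^ q \<le> card (B1 \<union> B2)"
  shows "(real q - real p) / 2 - L2_norm circle E * (2 * (1 / 2) ^ p)
    \<le> 16 * (LINT x|circle. norm (fourier_indicator B1 x + fourier_indicator B2 x + E x))"
proof (cases "p \<le> q")
  case False
  have "(real q - real p) / 2 - L2_norm circle E * (2 * (1 / 2) ^ p) \<le> 0 - 0"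
    using False by (intro diff_mono) (auto simp: L2_norm_nonneg)
  also have "\<dots> \<le> 16 * (LINT x|circle. norm (fourier_indicator B1 x + fourier_indicator B2 x + E x))"
    by simp
  finally show ?thesis .
next
  case True
  define A where "A = B1 \<union> B2"
  obtain S where S: "blocks S p q" and sub: "(\<Union>j\<in>{p..<q}. S j) \<subseteq> A"
    and above: "\<And>m n. m \<in> (\<Union>j\<in>{p..<q}. S j) \<Longrightarrow> n \<in> A - (\<Union>j\<in>{p..<q}. S j) \<Longrightarrow> m < n"
    using blocks_exist[of A p q] fin True q unfolding A_def by (metis finite_Un)
  interpret blocks S p q by (fact S)
  define a where "a n = (LINT x|circle. e (- (of_int n * x)) * F q x)" for n
  have in_block: "1 / 2 * (1 / 4) ^ j \<le> Re (a n)" if "j \<in> {p..<q}" "n \<in> S j" for j n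
    using fourier_coeff_F[OF that] abs_Re_le_cmod[of "a n - 1 / 4 ^ j"]
    by (simp add: a_def[symmetric] power_one_over Re_divide_of_real[of 1 "4 ^ j", simplified])
  have outside: "a n = 0" if "n \<in> A - (\<Union>j\<in>{p..<q}. S j)" for n
    unfolding a_def
  proof (rule fourier_coeff_F_zero)
    show "m < n" if "j \<in> {p..<q}" "m \<in> S j" for j m
      using above[of m n] that \<open>n \<in> A - _\<close> by blast
  qed
  have "Re (a n) \<ge> 0" if n: "n \<in> A" for n
  proof (cases "n \<in> (\<Union>j\<in>{p..<q}. S j)")
    case True
    then obtain j where "j \<in> {p..<q}" "n \<in> S j" by auto
    from in_block[OF this] show ?thesis by (rule order_trans[rotated]) simp
  qed (use outside n in auto)
  then have "(\<Sum>n\<in>A. Re (a n)) - L2_norm circle E * L2_norm circle (F q) \<le>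
      16 * (LINT x|circle. norm (fourier_indicator B1 x + fourier_indicator B2 x + E x))"
    unfolding A_def a_def
    by (intro duality_lower_bound fin E continuous_on_F norm_F_le True order_refl)
  moreover have "L2_norm circle E * L2_norm circle (F q) \<le> L2_norm circle E * (2 * (1 / 2) ^ p)"
    by (intro mult_left_mono L2_norm_F L2_norm_nonneg)
  moreover have "(real q - real p) / 2 \<le> (\<Sum>n\<in>A. Re (a n))"
  proof -
    have "(real q - real p) / 2 = (\<Sum>j\<in>{p..<q}. 1 / 2)"
      using True by (simp add: of_nat_diff)
    also have "\<dots> = (\<Sum>j\<in>{p..<q}. \<Sum>n\<in>S j. 1 / 2 * (1 / 4) ^ j)"
      by (intro sum.cong) (auto simp: card_S power_one_over)
    also have "\<dots> \<le> (\<Sum>j\<in>{p..<q}. \<Sum>n\<in>S j. Re (a n))"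
      by (intro sum_mono in_block)
    also have "\<dots> = (\<Sum>n\<in>(\<Union>j\<in>{p..<q}. S j). Re (a n))"
    proof (rule sum.UNION_disjoint[symmetric])
      show "\<forall>i\<in>{p..<q}. \<forall>j\<in>{p..<q}. i \<noteq> j \<longrightarrow> S i \<inter> S j = {}"
        using S_less by (metis disjoint_iff linorder_neqE_nat order.irrefl)
    qed (auto intro!: finite_S)
    also have "\<dots> = (\<Sum>n\<in>A. Re (a n))"
      using sub outside fin by (intro sum.mono_neutral_left) (auto simp: A_def)
    finally show ?thesis .
  qed
  ultimately show ?thesis by linarith
qed

text \<open>The normalised indicator has coefficients of total 1 on the union, sup norm at most 1,
  and L2 norm equal to the inverse square root of the cardinality.\<close>

lemma L1_norm_lower_bound_average:
  assumes fin: "finite B1" "finite B2" and E: "square_integrable circle E" and ne: "B1 \<union> B2 \<noteq> {}"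
  shows "1 - L2_norm circle E / sqrt (card (B1 \<union> B2))
    \<le> (LINT x|circle. norm (fourier_indicator B1 x + fourier_indicator B2 x + E x))"
proof -
  define A where "A = B1 \<union> B2"
  define N where "N = real (card A)"
  have A: "finite A" "N > 0" using fin ne by (auto simp: A_def N_def card_gt_0_iff)
  define F where "F x = (1 / of_real N) * fourier_indicator A x" for x
  have coeff: "(LINT x|circle. e (- (of_int n * x)) * F x) = of_bool (n \<in> A) / of_real N" for n
  proof -
    have "e (- (of_int n * x)) * F x = (1 / of_real N) * (e (- (of_int n * x)) * fourier_indicator A x)" for x
      by (simp add: F_def)
    then show ?thesis
      by (simp only: integral_mult_right_zero fourier_coeff_indicator A(1)) simp
  qed
  have "(\<Sum>n\<in>A. Re (LINT x|circle. e (- (of_int n * x)) * F x)) - L2_norm circle E * L2_norm circle F \<le>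
      1 * (LINT x|circle. norm (fourier_indicator B1 x + fourier_indicator B2 x + E x))"
    unfolding A_def
  proof (rule duality_lower_bound[OF fin E])
    show "continuous_on UNIV F" unfolding F_def by (intro continuous_intros)
    show "norm (F x) \<le> 1" for x
      using norm_fourier_indicator_le[of A x] A(2)
      by (simp add: F_def norm_mult norm_divide N_def field_simps)
  qed (use A(2) in \<open>simp add: coeff Re_divide_of_real\<close>)
  moreover have "L2_norm circle F = 1 / sqrt N"
    using A unfolding F_def L2_norm_mult_left
    by (simp add: L2_norm_fourier_indicator norm_divide N_def[symmetric] real_div_sqrt field_simps)
  moreover have "(\<Sum>n\<in>A. Re (LINT x|circle. e (- (of_int n * x)) * F x)) = 1"
    using A(2) by (simp add: coeff Re_divide_of_real N_def[symmetric])
  ultimately show ?thesis by (simp add: A_def[symmetric] N_def)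
qed

section \<open>Choice of scales\<close>

text \<open>\<open>p\<close> is the first scale at which the pairing with the error is bounded,
  \<open>q\<close> the last whose power of 4 fits into \<open>N\<close>. Rounding costs at most 2 in
  the number of scales.\<close>

lemma scales_bounds:
  fixes K N :: real
  assumes "1 \<le> K" "K \<le> N" and p: "p = nat \<lceil>log 4 (N / K\<^sup>2)\<rceil>" and q: "q = nat \<lfloor>log 4 N\<rfloor>"
  shows "4 ^ q \<le> N" "sqrt N / K * (1 / 2) ^ p \<le> 1" "real q - real p \<ge> log 4 K - 2"
proof -
  have pos: "K > 0" "N > 0" using assms by auto
  have log: "0 \<le> log 4 K" "log 4 K \<le> log 4 N" "log 4 (N / K\<^sup>2) = log 4 N - 2 * log 4 K"
    using assms pos by (auto simp: log_divide log_nat_power)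
  have "(4::real) ^ q = 4 powr real q" by (simp add: powr_realpow)
  also have "\<dots> \<le> 4 powr (log 4 N)"
    using log unfolding q by (intro powr_mono) auto
  also have "\<dots> = N" using pos by simp
  finally show "4 ^ q \<le> N" .
  have "N / K\<^sup>2 = 4 powr (log 4 (N / K\<^sup>2))" using pos by simp
  also have "\<dots> \<le> 4 powr real p" unfolding p by (intro powr_mono) linarith+
  also have "\<dots> = (2 ^ p)\<^sup>2"
    using power_mult[of "2::real" 2 p] power_mult[of "2::real" p 2] by (simp add: powr_realpow mult.commute)
  finally have "(sqrt N / K)\<^sup>2 \<le> (2 ^ p)\<^sup>2" using pos by (simp add: power_divide)
  then have "sqrt N / K \<le> 2 ^ p" by (rule power2_le_imp_le) simp
  then have "sqrt N / K * (1 / 2) ^ p \<le> 2 ^ p * (1 / 2) ^ p"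
    by (rule mult_right_mono) simp
  also have "\<dots> = 1" by (simp flip: power_mult_distrib)
  finally show "sqrt N / K * (1 / 2) ^ p \<le> 1" .
  have "real q \<ge> log 4 N - 1" unfolding q by linarith
  \<comment> \<open>If the maximum is 0, the gap is at least \<open>log 4 N - 1\<close> and
    \<open>K \<le> N\<close> is used; otherwise it is at least
    \<open>2 * log 4 K - 2\<close>.\<close>
  moreover have "real p \<le> max 0 (log 4 N - 2 * log 4 K + 1)" unfolding p log(3) by linarith
  ultimately show "real q - real p \<ge> log 4 K - 2" using log by linarith
qed

theorem theorem7p8:
  "\<exists>c::real. c > 0 \<and>
     (\<forall>(K::real) (B1::int set) (B2::int set) (E::real \<Rightarrow> complex).
        K \<ge> 1 \<longrightarrow> finite B1 \<longrightarrow> finite B2 \<longrightarrow> real (card B1) \<ge> K \<longrightarrow>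
        E \<in> L2_circle \<longrightarrow> Lp_norm 2 E \<le> sqrt (real (card B1)) / K \<longrightarrow>
        Lp_norm 1 (\<lambda>t. fourier_indicator B1 t + fourier_indicator B2 t + E t) \<ge> c * ln K)"
proof (intro exI[of _ "1 / 4 ^ 12"] conjI allI impI)
  fix K :: real and B1 B2 :: "int set" and E :: "real \<Rightarrow> complex"
  assume K: "K \<ge> 1" and fin: "finite B1" "finite B2" and card: "real (card B1) \<ge> K"
    and "E \<in> L2_circle" and "Lp_norm 2 E \<le> sqrt (real (card B1)) / K"
  define N where "N = real (card (B1 \<union> B2))"
  define I where "I = (LINT x|circle. norm (fourier_indicator B1 x + fourier_indicator B2 x + E x))"
  have E: "square_integrable circle E" by (rule L2_circle_square_integrable) fact
  have "card B1 \<le> card (B1 \<union> B2)" using fin by (intro card_mono) auto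
  then have N: "real (card B1) \<le> N" "K \<le> N" using card by (auto simp: N_def)
  have "sqrt (real (card B1)) / K \<le> sqrt N / K" using N K by (intro divide_right_mono) auto
  with \<open>Lp_norm 2 E \<le> _\<close> have L2E: "L2_norm circle E \<le> sqrt N / K" by (simp add: Lp_norm_2_eq)
  have lnK: "0 \<le> ln K" using K by simp
  have "1 / 4 ^ 12 * ln K \<le> I"
  proof (cases "K \<le> 4 ^ 12")
    case True
    have "B1 \<union> B2 \<noteq> {}" using card K by auto
    have "1 / 4 ^ 12 * ln K \<le> 1 / K * ln K"
      using True K lnK by (intro mult_right_mono divide_left_mono) auto
    \<comment> \<open>Both \<open>ln K\<close> and the available bound \<open>1 - 1 / K\<close>
      vanish at \<open>K = 1\<close>; the inequality \<open>ln K \<le> K - 1\<close> compares them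
      down to that point.\<close>
    also have "\<dots> \<le> 1 / K * (K - 1)" using K by (intro mult_left_mono ln_le_minus_one) auto
    also have "\<dots> = 1 - 1 / K" using K by (simp add: field_simps)
    also have "\<dots> \<le> 1 - L2_norm circle E / sqrt N"
    proof -
      have "L2_norm circle E / sqrt N \<le> sqrt N / K / sqrt N" using L2E N K by (intro divide_right_mono) auto
      also have "\<dots> = 1 / K" using N K by simp
      finally show ?thesis by simp
    qed
    also have "\<dots> \<le> I"
      unfolding I_def N_def by (rule L1_norm_lower_bound_average) fact+
    finally show ?thesis .
  next
    case False
    define p where "p = nat \<lceil>log 4 (N / K\<^sup>2)\<rceil>"
    define q where "q = nat \<lfloor>log 4 N\<rfloor>"
    note sc = scales_bounds[OF K N(2) p_def q_def]
    have "real (4 ^ q) \<le> real (card (B1 \<union> B2))" using sc(1) by (simp add: N_def)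
    then have "(real q - real p) / 2 - L2_norm circle E * (2 * (1 / 2) ^ p) \<le> 16 * I"
      unfolding I_def of_nat_le_iff by (rule L1_norm_lower_bound_scales[OF fin E])
    moreover have "L2_norm circle E * (1 / 2) ^ p \<le> sqrt N / K * (1 / 2) ^ p"
      using L2E by (intro mult_right_mono) auto
    with sc(2) have "L2_norm circle E * (2 * (1 / 2) ^ p) \<le> 2" by simp
    moreover have "(log 4 K - 2) / 2 \<le> (real q - real p) / 2"
      using sc(3) by (intro divide_right_mono) auto
    ultimately have "(log 4 K - 2) / 2 - 2 \<le> 16 * I" by linarith
    moreover have "12 \<le> log 4 K"
    proof -
      have "(12::real) = log 4 (4 ^ 12)" by (subst log_nat_power) auto
      also have "\<dots> \<le> log 4 K" using False by (subst log_le_cancel_iff) auto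
      finally show ?thesis .
    qed
    \<comment> \<open>The left side is \<open>s / 2 - 3\<close>, which is at least
      \<open>s / 4\<close> exactly when \<open>s \<ge> 12\<close>; this fixes the threshold
      \<open>4 ^ 12\<close>.\<close>
    moreover have "s / 64 \<le> t" if "(s - 2) / 2 - 2 \<le> 16 * t" "12 \<le> s" for s t :: real
      using that by (simp add: field_simps)
    ultimately have "log 4 K / 64 \<le> I" by blast
    moreover have "1 / 4 ^ 12 * ln K \<le> log 4 K / 64"
    proof -
      have "ln K = log 4 K * ln 4" by (simp add: log_def)
      also have "\<dots> \<le> log 4 K * 3" using \<open>12 \<le> log 4 K\<close> ln_le_minus_one[of "4::real"] by (intro mult_left_mono) auto
      finally show ?thesis using lnK \<open>12 \<le> log 4 K\<close> by simp
    qed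
    ultimately show ?thesis by linarith
  qed
  then show "Lp_norm 1 (\<lambda>t. fourier_indicator B1 t + fourier_indicator B2 t + E t) \<ge> 1 / 4 ^ 12 * ln K"
    by (simp add: Lp_norm_1_eq I_def)
qed simp

end
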